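(* Let $(X_1,x_1)$ and $(X_2,x_2)$ be two pointed spaces, $(X,x_* )=(X_1,x_1)\vee(X_2,x_2)$, and $n\ge 1$. Also let $\{x_1\}$ be a closed subset of $X_1$, and let $x\in X_1$ with $x\neq x_1$. (i) All $n$-loops in $X$ at $x_*$ are small if and only if $$\mathcal{H}_n(X,x_* )=j_*\mathcal{H}_n(U_1\vee U_2,x_* )$$ for any neighbourhoods $U_1$ and $U_2$ of $x_1$ and $x_2$ in $X_1$ and $X_2$, respectively, where $j:U_1\vee U_2\to X$ is the inclusion map. (ii) If all $n$-loops in $X$ at $x$ are small, then $$\mathcal{H}_n(X,x)=\mathcal{H}_n(X_1,x).$$
   Context: For $n\ge 1$ the $n$-dimensional Hawaiian earring is $\mathbb{HE}^n=\{(r_0,\dots,r_n)\in\mathbb{R}^{n+1} : (r_0-1/k)^2+\sum_{i=1}^n r_i^2=(1/k)^2 \text{ for some } k\in\mathbb{N}\}$, with base point $\theta=(0,\dots,0)$; $\mathbb{S}^n_k$ denotes its sphere of radius $1/k$. All homotopies are relative to base points. The $n$th Hawaiian group $\mathcal{H}_n(X,x_0)$ is the set of pointed homotopy classes $[f]$ of pointed maps $f:(\mathbb{HE}^n,\theta)\to(X,x_0)$, with the operation induced sphere by sphere from that of the $n$th homotopy group: $[f][g]=[f*g]$, where $(f*g)|_{\mathbb{S}^n_k}=f|_{\mathbb{S}^n_k}*g|_{\mathbb{S}^n_k}$ for all $k$. A pointed map $\beta$ induces a homomorphism $\beta_*:[f]\mapsto[\beta\circ f]$ of Hawaiian groups.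 $X_1$ is regarded as a subspace of the wedge $X$; since it is a retract of $X$, the homomorphism $\mathcal{H}_n(X_1,x)\to\mathcal{H}_n(X,x)$ induced by inclusion is injective for $x\in X_1$, and $\mathcal{H}_n(X_1,x)$ is identified with its image. An $n$-loop at $x$ in $X$ is a pointed map $\alpha:(\mathbb{S}^n,1)\to(X,x)$. It is small if for every open neighbourhood $U$ of $x$ it is homotopic in $X$ (relative to the base point) to an $n$-loop with image in $U$. *)

theory Defs
  imports "HOL-Analysis.Analysis" "HOL-Algebra.Group"
begin

section \<open>Neighbourhoods and wedges of pointed spaces\<close>

definition neighbourhood_in :: "'a topology \<Rightarrow> 'a \<Rightarrow> 'a set \<Rightarrow> bool" where
  "neighbourhood_in X p U \<longleftrightarrow> U \<subseteq> topspace X \<and> (\<exists>V. openin X V \<and> p \<in> V \<and> V \<subseteq> U)"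

text \<open>
  Every class of the relation generated by \<open>Inl x1 \<sim> Inr x2\<close> on the disjoint union is
  represented by its image under \<open>wedge_proj\<close>; thus the base point of the wedge is \<open>Inl x1\<close>, and
  the wedge carries the quotient topology of the disjoint union.
\<close>

definition wedge_proj :: "'a \<Rightarrow> 'b \<Rightarrow> 'a + 'b \<Rightarrow> 'a + 'b" where
  "wedge_proj x1 x2 = id(Inr x2 := Inl x1)"

definition wedge :: "'a topology \<Rightarrow> 'a \<Rightarrow> 'b topology \<Rightarrow> 'b \<Rightarrow> ('a + 'b) topology" where
  "wedge X1 x1 X2 x2 = topology (\<lambda>W.
     W \<subseteq> wedge_proj x1 x2 ` (topspace X1 <+> topspace X2) \<and>
     openin X1 {a \<in> topspace X1. wedge_proj x1 x2 (Inl a) \<in> W} \<and>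
     openin X2 {b \<in> topspace X2. wedge_proj x1 x2 (Inr b) \<in> W})"

lemma openin_wedge:
  "openin (wedge X1 x1 X2 x2) W \<longleftrightarrow>
     W \<subseteq> wedge_proj x1 x2 ` (topspace X1 <+> topspace X2) \<and>
     openin X1 {a \<in> topspace X1. wedge_proj x1 x2 (Inl a) \<in> W} \<and>
     openin X2 {b \<in> topspace X2. wedge_proj x1 x2 (Inr b) \<in> W}"
proof -
  let ?q = "wedge_proj x1 x2"
  have Int: "{a \<in> A. f a \<in> S \<inter> T} = {a \<in> A. f a \<in> S} \<inter> {a \<in> A. f a \<in> T}"
    for A :: "'c set" and f :: "'c \<Rightarrow> 'a + 'b" and S T by auto
  have Un: "{a \<in> A. f a \<in> \<Union>K} = (\<Union>W\<in>K. {a \<in> A. f a \<in> W})"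
    for A :: "'c set" and f :: "'c \<Rightarrow> 'a + 'b" and K by auto
  have "istopology (\<lambda>W. W \<subseteq> ?q ` (topspace X1 <+> topspace X2) \<and>
     openin X1 {a \<in> topspace X1. ?q (Inl a) \<in> W} \<and>
     openin X2 {b \<in> topspace X2. ?q (Inr b) \<in> W})"
    unfolding istopology_def Int Un by (intro conjI allI impI) auto
  then show ?thesis
    by (simp add: wedge_def topology_inverse')
qed

lemma topspace_wedge:
  "topspace (wedge X1 x1 X2 x2) = wedge_proj x1 x2 ` (topspace X1 <+> topspace X2)"
proof -
  let ?C = "wedge_proj x1 x2 ` (topspace X1 <+> topspace X2)"
  have "{a \<in> topspace X1. wedge_proj x1 x2 (Inl a) \<in> ?C} = topspace X1"
    "{b \<in> topspace X2. wedge_proj x1 x2 (Inr b) \<in> ?C} = topspace X2"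
    by auto
  then have "openin (wedge X1 x1 X2 x2) ?C"
    by (simp add: openin_wedge)
  moreover have "W \<subseteq> ?C" if "openin (wedge X1 x1 X2 x2) W" for W
    using that by (simp add: openin_wedge)
  ultimately show ?thesis
    by (metis openin_subset openin_topspace subset_antisym)
qed

section \<open>Small n-loops\<close>

definition nsphere_base :: "nat \<Rightarrow> real" where
  "nsphere_base = (\<lambda>i. if i = 0 then 1 else 0)"

definition n_loop :: "nat \<Rightarrow> 'a topology \<Rightarrow> 'a \<Rightarrow> ((nat \<Rightarrow> real) \<Rightarrow> 'a) \<Rightarrow> bool" where
  "n_loop n X x \<alpha> \<longleftrightarrow> continuous_map (nsphere n) X \<alpha> \<and> \<alpha> nsphere_base = x"

definition small_n_loop :: "nat \<Rightarrow> 'a topology \<Rightarrow> 'a \<Rightarrow> ((nat \<Rightarrow> real) \<Rightarrow> 'a) \<Rightarrow> bool" where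
  "small_n_loop n X x \<alpha> \<longleftrightarrow> n_loop n X x \<alpha> \<and>
     (\<forall>U. openin X U \<and> x \<in> U \<longrightarrow>
        (\<exists>\<beta>. n_loop n X x \<beta> \<and> \<beta> ` topspace (nsphere n) \<subseteq> U \<and>
             homotopic_with (\<lambda>h. h nsphere_base = x) (nsphere n) X \<alpha> \<beta>))"

section \<open>The Hawaiian earring and Hawaiian groups\<close>

text \<open>As in \<^const>\<open>Euclidean_space\<close>, a point of (n+1)-space is a sequence vanishing from n+1 on.\<close>

definition earring_sphere :: "nat \<Rightarrow> nat \<Rightarrow> (nat \<Rightarrow> real) set" where
  "earring_sphere n k = {r \<in> topspace (Euclidean_space (Suc n)).
     (r 0 - 1 / real k)\<^sup>2 + (\<Sum>i=1..n. (r i)\<^sup>2) = (1 / real k)\<^sup>2}"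

definition hawaiian_earring :: "nat \<Rightarrow> (nat \<Rightarrow> real) topology" where
  "hawaiian_earring n = subtopology (Euclidean_space (Suc n)) (\<Union>k\<in>{1..}. earring_sphere n k)"

definition earring_base :: "nat \<Rightarrow> real" where
  "earring_base = (\<lambda>i. 0)"

definition hawaiian_map :: "nat \<Rightarrow> 'a topology \<Rightarrow> 'a \<Rightarrow> ((nat \<Rightarrow> real) \<Rightarrow> 'a) \<Rightarrow> bool" where
  "hawaiian_map n X x f \<longleftrightarrow> continuous_map (hawaiian_earring n) X f \<and> f earring_base = x"

definition hawaiian_class ::
  "nat \<Rightarrow> 'a topology \<Rightarrow> 'a \<Rightarrow> ((nat \<Rightarrow> real) \<Rightarrow> 'a) \<Rightarrow> ((nat \<Rightarrow> real) \<Rightarrow> 'a) set" where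
  "hawaiian_class n X x f =
     {g. homotopic_with (\<lambda>h. h earring_base = x) (hawaiian_earring n) X f g}"

text \<open>
  The product of two n-loops is the pinch map, collapsing the equator \<open>r 1 = 0\<close> of the sphere to
  the base point, followed by the first loop on the hemisphere \<open>r 1 \<le> 0\<close> and the second one on
  the hemisphere \<open>r 1 \<ge> 0\<close>.  The pinch map used here doubles the angular distance from the pole of
  the respective hemisphere and then rotates the opposite pole, to which the equator has been
  sent, to the base point; in the coordinates \<open>u = k r - e\<^sub>0\<close> centred and scaled to the unit sphere
  it is \<open>u \<mapsto> (2 u\<^sub>1\<^sup>2 - 1, - 2 u\<^sub>0 u\<^sub>1, 2 \<bar>u\<^sub>1\<bar> u\<^sub>2, \<dots>, 2 \<bar>u\<^sub>1\<bar> u\<^sub>n)\<close>.  Its restriction to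
  either hemisphere, extended by the base point to the other one, is homotopic to the identity of
  the sphere relative to the base point; for n = 1 both loops are traversed
  counterclockwise, the first one first.
\<close>

definition sphere_pinch :: "nat \<Rightarrow> (nat \<Rightarrow> real) \<Rightarrow> (nat \<Rightarrow> real)" where
  "sphere_pinch k r = (\<lambda>i.
     if i = 0 then 2 * real k * (r 1)\<^sup>2
     else if i = 1 then 2 * r 1 * (1 - real k * r 0)
     else 2 * real k * \<bar>r 1\<bar> * r i)"

lemma sphere_pinch_in_sphere:
  assumes "n \<ge> 1" "k \<ge> 1" and r: "r \<in> earring_sphere n k"
  shows "sphere_pinch k r \<in> earring_sphere n k"
proof -
  define T where "T = (\<Sum>i=2..n. (r i)\<^sup>2)"
  define a where "a = real k"
  have a: "a > 0" using assms(2) by (simp add: a_def)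
  have split: "(\<Sum>i=1..n. f i) = f 1 + (\<Sum>i=2..n. f i)" for f :: "nat \<Rightarrow> real"
    using assms(1) by (simp add: sum.atLeast_Suc_atMost numeral_2_eq_2)
  have e: "(r 0 - 1 / a)\<^sup>2 + ((r 1)\<^sup>2 + T) = (1 / a)\<^sup>2"
    using r by (simp only: earring_sphere_def split T_def a_def mem_Collect_eq)
  then have "T = 2 * r 0 / a - (r 0)\<^sup>2 - (r 1)\<^sup>2"
    by (simp add: power2_eq_square algebra_simps)
  then have T: "a * T = 2 * r 0 - a * (r 0)\<^sup>2 - a * (r 1)\<^sup>2"
    using a by (simp add: field_simps)
  have s: "(\<Sum>i=2..n. (sphere_pinch k r i)\<^sup>2) = (2 * a * \<bar>r 1\<bar>)\<^sup>2 * T"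
    unfolding T_def sum_distrib_left
    by (rule sum.cong) (auto simp: sphere_pinch_def a_def power_mult_distrib)
  have "(2 * a * \<bar>r 1\<bar>)\<^sup>2 * T = 4 * a * (r 1)\<^sup>2 * (a * T)"
    by (simp add: power2_eq_square)
  also have "\<dots> = 4 * a * (r 1)\<^sup>2 * (2 * r 0 - a * (r 0)\<^sup>2 - a * (r 1)\<^sup>2)"
    by (simp only: T)
  finally have s': "(\<Sum>i=2..n. (sphere_pinch k r i)\<^sup>2) = \<dots>"
    by (rule s[THEN trans])
  have "(2 * a * y\<^sup>2 - c)\<^sup>2 + ((2 * y * (1 - a * z))\<^sup>2
      + 4 * a * y\<^sup>2 * (2 * z - a * z\<^sup>2 - a * y\<^sup>2)) = c\<^sup>2"
    if "a * c = 1" for c y z :: real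
    using that by algebra
  from this[of "1 / a" "r 1" "r 0"] a
  have "(2 * a * (r 1)\<^sup>2 - 1 / a)\<^sup>2 + ((2 * r 1 * (1 - a * r 0))\<^sup>2
      + 4 * a * (r 1)\<^sup>2 * (2 * r 0 - a * (r 0)\<^sup>2 - a * (r 1)\<^sup>2)) = (1 / a)\<^sup>2"
    by simp
  then have "(sphere_pinch k r 0 - 1 / real k)\<^sup>2 + (\<Sum>i=1..n. (sphere_pinch k r i)\<^sup>2)
      = (1 / real k)\<^sup>2"
    unfolding split s' by (simp add: sphere_pinch_def a_def)
  then show ?thesis
    using r assms(1) by (auto simp: earring_sphere_def topspace_Euclidean_space sphere_pinch_def)
qed

lemma sphere_pinch_equator:
  assumes "r 1 = 0"
  shows "sphere_pinch k r = earring_base"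
  using assms by (auto simp: sphere_pinch_def earring_base_def)

text \<open>
  The index below is unique except at the base point, which lies on all spheres and is fixed by
  every \<open>sphere_pinch k\<close>.
\<close>

definition earring_index :: "nat \<Rightarrow> (nat \<Rightarrow> real) \<Rightarrow> nat" where
  "earring_index n r = (SOME k. k \<ge> 1 \<and> r \<in> earring_sphere n k)"

definition hawaiian_concat ::
  "nat \<Rightarrow> ((nat \<Rightarrow> real) \<Rightarrow> 'a) \<Rightarrow> ((nat \<Rightarrow> real) \<Rightarrow> 'a) \<Rightarrow> (nat \<Rightarrow> real) \<Rightarrow> 'a" where
  "hawaiian_concat n f g r =
     (if r 1 \<le> 0 then f else g) (sphere_pinch (earring_index n r) r)"

definition hawaiian_group ::
  "nat \<Rightarrow> 'a topology \<Rightarrow> 'a \<Rightarrow> ((nat \<Rightarrow> real) \<Rightarrow> 'a) set monoid" where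
  "hawaiian_group n X x =
     \<lparr> carrier = hawaiian_class n X x ` {f. hawaiian_map n X x f},
       monoid.mult = (\<lambda>A B. \<Union>f\<in>A. \<Union>g\<in>B. hawaiian_class n X x (hawaiian_concat n f g)),
       one = hawaiian_class n X x (\<lambda>r. x) \<rparr>"

text \<open>The map induced by \<open>\<beta>\<close>; the target space \<open>Y\<close> with base point \<open>y\<close> is a parameter.\<close>

definition hawaiian_induced ::
  "nat \<Rightarrow> 'b topology \<Rightarrow> 'b \<Rightarrow> ('a \<Rightarrow> 'b)
     \<Rightarrow> ((nat \<Rightarrow> real) \<Rightarrow> 'a) set \<Rightarrow> ((nat \<Rightarrow> real) \<Rightarrow> 'b) set" where
  "hawaiian_induced n Y y \<beta> A = (\<Union>f\<in>A. hawaiian_class n Y y (\<beta> \<circ> f))"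

lemma hawaiian_induced_class:
  assumes f: "hawaiian_map n X x f" and \<beta>: "continuous_map X Y \<beta>" "\<beta> x = y"
  shows "hawaiian_induced n Y y \<beta> (hawaiian_class n X x f) = hawaiian_class n Y y (\<beta> \<circ> f)"
proof -
  have "f \<in> hawaiian_class n X x f"
    using f by (simp add: hawaiian_class_def hawaiian_map_def)
  moreover have "hawaiian_class n Y y (\<beta> \<circ> g) = hawaiian_class n Y y (\<beta> \<circ> f)"
    if "g \<in> hawaiian_class n X x f" for g
  proof -
    have "homotopic_with (\<lambda>h. h earring_base = y) (hawaiian_earring n) Y (\<beta> \<circ> f) (\<beta> \<circ> g)"
    proof (rule homotopic_with_compose_continuous_map_left)
      show "homotopic_with (\<lambda>h. h earring_base = x) (hawaiian_earring n) X f g"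
        using that by (simp add: hawaiian_class_def)
    qed (use \<beta> in auto)
    then show ?thesis
      unfolding hawaiian_class_def by (blast intro: homotopic_with_trans homotopic_with_symD)
  qed
  ultimately show ?thesis
    unfolding hawaiian_induced_def by blast
qed

end

theory Submission
  imports Defs
begin

text \<open>
  If all n-loops at the base point are small and \<open>V\<close> is an open neighbourhood of it, then a map
  on the Hawaiian earring sends all but finitely many of the spheres into \<open>V\<close>, and the
  restrictions to the finitely many remaining ones can be homotoped into \<open>V\<close> one at a time.
  So every class is represented by a map into \<open>V\<close>.  For (i) take
  \<open>V\<close> inside \<open>U\<^sub>1 \<or> U\<^sub>2\<close>; for (ii) take \<open>V\<close> to be the complement of \<open>x\<^sub>1\<close> in \<open>X\<^sub>1\<close>,
  which is open in the wedge.  Conversely, extending an n-loop by a constant from the first sphere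
  to the whole earring gives smallness from the group equality.
\<close>

section \<open>Spheres and tails of the earring\<close>

lemma Euclidean_space_top_of_set: "Euclidean_space n = top_of_set {x. \<forall>i\<ge>n. x i = 0}"
  by (simp add: Euclidean_space_def euclidean_product_topology)

lemma nsphere_top_of_set:
  "nsphere n = top_of_set {x. (\<Sum>i\<le>n. x i ^ 2) = 1 \<and> (\<forall>i>n. x i = 0)}"
  by (simp add: nsphere euclidean_product_topology)

text \<open>Expanding the square cancels \<open>(1 / k)\<^sup>2\<close>. The resulting equation is
  linear in \<open>k\<close>, which makes different spheres easy to compare.\<close>

lemma mem_earring_sphere:
  assumes "k \<ge> 1"
  shows "r \<in> earring_sphere n k \<longleftrightarrow>
    (\<forall>i>n. r i = 0) \<and> real k * (\<Sum>i\<le>n. (r i)\<^sup>2) = 2 * r 0"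
proof -
  have k: "real k > 0" using assms by simp
  have split: "(\<Sum>i\<le>n. (r i)\<^sup>2) = (r 0)\<^sup>2 + (\<Sum>i=1..n. (r i)\<^sup>2)"
    by (simp add: atMost_atLeast0 sum.atLeast_Suc_atMost)
  have "(r 0 - 1 / real k)\<^sup>2 + S - (1 / real k)\<^sup>2 = (real k * ((r 0)\<^sup>2 + S) - 2 * r 0) / real k" for S
    using k by (simp add: power2_eq_square field_simps)
  then have "(r 0 - 1 / real k)\<^sup>2 + S = (1 / real k)\<^sup>2 \<longleftrightarrow> real k * ((r 0)\<^sup>2 + S) = 2 * r 0" for S
    using k by (metis (no_types, lifting) eq_iff_diff_eq_0 divide_eq_0_iff less_irrefl)
  then show ?thesis
    by (auto simp: earring_sphere_def topspace_Euclidean_space Suc_le_eq split)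
qed

definition earring_tail :: "nat \<Rightarrow> nat \<Rightarrow> (nat \<Rightarrow> real) set" where
  "earring_tail n K = (\<Union>k\<in>{K..}. earring_sphere n k)"

lemma earring_tail_unfold: "earring_tail n K = earring_sphere n K \<union> earring_tail n (Suc K)"
proof -
  have "{K..} = insert K {Suc K..}" by auto
  then show ?thesis by (simp add: earring_tail_def)
qed

lemma hawaiian_earring_top_of_set: "hawaiian_earring n = top_of_set (earring_tail n 1)"
proof -
  have "earring_tail n 1 \<subseteq> {x. \<forall>i\<ge>Suc n. x i = 0}"
    by (auto simp: earring_tail_def earring_sphere_def topspace_Euclidean_space)
  then show ?thesis
    by (simp only: hawaiian_earring_def Euclidean_space_top_of_set subtopology_subtopology
        Int_absorb1 flip: earring_tail_def)
qed

lemma topspace_hawaiian_earring: "topspace (hawaiian_earring n) = earring_tail n 1"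
  by (simp add: hawaiian_earring_top_of_set)

lemma earring_base_in_sphere: "k \<ge> 1 \<Longrightarrow> earring_base \<in> earring_sphere n k"
  by (simp add: mem_earring_sphere earring_base_def)

lemma earring_sphere_sum_pos:
  assumes "k \<ge> 1" "r \<in> earring_sphere n k" "r \<noteq> earring_base"
  shows "(\<Sum>i\<le>n. (r i)\<^sup>2) > 0"
proof (rule ccontr)
  assume "\<not> ?thesis"
  then have "(\<Sum>i\<le>n. (r i)\<^sup>2) = 0"
    using sum_nonneg[of "{..n}" "\<lambda>i. (r i)\<^sup>2"] by simp
  then have "\<forall>i\<le>n. r i = 0"
    by (simp add: sum_nonneg_eq_0_iff)
  moreover have "\<forall>i>n. r i = 0"
    using assms mem_earring_sphere by blast
  ultimately have "r = earring_base"
    by (auto simp: earring_base_def fun_eq_iff) (metis not_le)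
  with assms show False by simp
qed

text \<open>Both sphere equations have the right-hand side \<open>2 * r 0\<close>, so
  \<open>k\<close> and \<open>l\<close> agree after multiplication by the sum of squares, which is
  positive off the base point.\<close>

lemma earring_spheres_meet:
  assumes "k \<ge> 1" "l \<ge> 1" "r \<in> earring_sphere n k" "r \<in> earring_sphere n l" "k \<noteq> l"
  shows "r = earring_base"
proof (rule ccontr)
  assume "r \<noteq> earring_base"
  then have "(\<Sum>i\<le>n. (r i)\<^sup>2) > 0"
    using assms earring_sphere_sum_pos by blast
  moreover have "real k * (\<Sum>i\<le>n. (r i)\<^sup>2) = real l * (\<Sum>i\<le>n. (r i)\<^sup>2)"
    using assms by (simp add: mem_earring_sphere)
  ultimately show False
    using \<open>k \<noteq> l\<close> by simp
qed

lemma earring_sphere_subset: "k \<ge> 1 \<Longrightarrow> earring_sphere n k \<subseteq> earring_tail n 1"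
  by (auto simp: earring_tail_def)

lemma earring_sphere_inter_tail:
  assumes "k \<ge> 1" "k < K" "r \<in> earring_sphere n k" "r \<in> earring_tail n K"
  shows "r = earring_base"
proof -
  obtain l where "K \<le> l" "r \<in> earring_sphere n l"
    using assms by (auto simp: earring_tail_def)
  with assms show ?thesis
    by (intro earring_spheres_meet[of k l]) auto
qed

lemma continuous_on_component:
  "continuous_on S (\<lambda>x. x i :: 'b::topological_space)"
  by (rule continuous_on_subset[OF continuous_on_product_coordinates subset_UNIV])

lemma continuous_on_sum_squares:
  "continuous_on S (\<lambda>r. c * (\<Sum>i\<le>n. (r i)\<^sup>2) :: real)"
  by (intro continuous_on_mult_left continuous_on_sum continuous_on_power continuous_on_component)

lemma closedin_earring_sphere:
  assumes "k \<ge> 1"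
  shows "closedin (hawaiian_earring n) (earring_sphere n k)"
proof -
  have "earring_sphere n k = {r \<in> earring_tail n 1. real k * (\<Sum>i\<le>n. (r i)\<^sup>2) = 2 * r 0}"
    using assms earring_sphere_subset[OF assms]
    by (auto simp: mem_earring_sphere earring_tail_def)
  also have "\<dots> = earring_tail n 1 \<inter> {r. real k * (\<Sum>i\<le>n. (r i)\<^sup>2) = 2 * r 0}"
    by auto
  finally show ?thesis
    unfolding hawaiian_earring_top_of_set
    by (simp only:) (intro closedin_closed_Int closed_Collect_eq continuous_on_sum_squares
        continuous_on_mult_left continuous_on_component)
qed

text \<open>A tail is an infinite union of closed sets, so closedness needs an argument. Off the
  base point the index of the sphere through \<open>r\<close> is \<open>2 * r 0\<close> divided by
  the sum of squares, so a single weak inequality between continuous functions cuts out the tail; at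
  the base point both sides vanish.\<close>

lemma closedin_earring_tail:
  assumes "K \<ge> 1"
  shows "closedin (hawaiian_earring n) (earring_tail n K)"
proof -
  have "r \<in> earring_tail n K \<longleftrightarrow> real K * (\<Sum>i\<le>n. (r i)\<^sup>2) \<le> 2 * r 0"
    if r: "r \<in> earring_tail n 1" for r
  proof (cases "r = earring_base")
    case True
    then show ?thesis
      using assms earring_base_in_sphere by (auto simp: earring_tail_def earring_base_def)
  next
    case False
    obtain k where k: "k \<ge> 1" "r \<in> earring_sphere n k"
      using r by (auto simp: earring_tail_def)
    have pos: "(\<Sum>i\<le>n. (r i)\<^sup>2) > 0"
      using k False earring_sphere_sum_pos by blast
    have "2 * r 0 = real k * (\<Sum>i\<le>n. (r i)\<^sup>2)"
      using k by (simp add: mem_earring_sphere)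
    then have "real K * (\<Sum>i\<le>n. (r i)\<^sup>2) \<le> 2 * r 0 \<longleftrightarrow> K \<le> k"
      using pos by simp
    moreover have "r \<in> earring_tail n K \<longleftrightarrow> K \<le> k"
      using k False earring_sphere_inter_tail[of k K r n]
      by (auto simp: earring_tail_def not_le[symmetric])
    ultimately show ?thesis by simp
  qed
  moreover have "earring_tail n K \<subseteq> earring_tail n 1"
    using assms by (force simp: earring_tail_def)
  ultimately have "earring_tail n K =
      earring_tail n 1 \<inter> {r. real K * (\<Sum>i\<le>n. (r i)\<^sup>2) \<le> 2 * r 0}"
    by blast
  then show ?thesis
    unfolding hawaiian_earring_top_of_set
    by (simp only:) (intro closedin_closed_Int closed_Collect_le continuous_on_sum_squares
        continuous_on_mult_left continuous_on_component)
qed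

text \<open>The sphere has diameter \<open>2 / k\<close> and passes through the origin. In formulas:
  \<open>k * (r 0)\<^sup>2 \<le> 2 * r 0\<close> bounds \<open>r 0\<close>, and then the sphere
  equation bounds the sum of squares.\<close>

lemma earring_sphere_coordinate_bound:
  assumes "k \<ge> 1" "r \<in> earring_sphere n k"
  shows "\<bar>r i\<bar> \<le> 2 / real k"
proof (cases "i \<le> n")
  case True
  have k: "real k > 0" using assms by simp
  define N where "N = (\<Sum>i\<le>n. (r i)\<^sup>2)"
  have eq: "real k * N = 2 * r 0"
    using assms by (simp add: mem_earring_sphere N_def)
  have le: "(r j)\<^sup>2 \<le> N" if "j \<le> n" for j
    unfolding N_def by (rule member_le_sum) (use that in auto)
  have "real k * (r 0)\<^sup>2 \<le> 2 * r 0"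
    using le[of 0] k eq by (metis mult_le_cancel_left_pos zero_le)
  then have "r 0 * (real k * r 0 - 2) \<le> 0"
    by (simp add: power2_eq_square algebra_simps)
  then have "real k * r 0 \<le> 2"
  proof (cases "r 0 > 0")
    case False
    then have "real k * r 0 \<le> 0"
      using k by (simp add: mult_le_0_iff)
    then show ?thesis by linarith
  qed (auto simp: mult_le_0_iff)
  then have r0: "r 0 \<le> 2 / real k"
    using k by (simp add: field_simps)
  have "N = 2 * r 0 / real k"
    using eq k by (simp add: field_simps)
  also have "\<dots> \<le> 2 * (2 / real k) / real k"
    using r0 k by (intro divide_right_mono mult_left_mono) auto
  also have "\<dots> = (2 / real k)\<^sup>2"
    by (simp add: power2_eq_square)
  finally have "(r i)\<^sup>2 \<le> (2 / real k)\<^sup>2"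
    using le[OF True] by simp
  then show ?thesis
    using k by (metis abs_le_square_iff abs_of_pos divide_pos_pos zero_less_numeral)
next
  case False
  with assms show ?thesis by (simp add: mem_earring_sphere)
qed

text \<open>The spheres shrink to the base point: a sequence with one point on each sphere converges
  to it, so it cannot leave an open neighbourhood infinitely often.\<close>

lemma earring_tail_subset_open:
  assumes W: "openin (hawaiian_earring n) W" "earring_base \<in> W"
  obtains K where "K \<ge> 1" "earring_tail n K \<subseteq> W"
proof -
  obtain O' where O': "open O'" "W = earring_tail n 1 \<inter> O'"
    using W by (auto simp: hawaiian_earring_top_of_set openin_open)
  \<comment> \<open>On each sphere not contained in \<open>O'\<close> this picks a point outside
    \<open>O'\<close>, so \<open>r k \<in> O'\<close> forces the whole sphere into
    \<open>O'\<close>.\<close>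
  define r where "r k = (SOME r. r \<in> earring_sphere n k \<and>
      ((\<exists>s \<in> earring_sphere n k. s \<notin> O') \<longrightarrow> r \<notin> O'))" for k
  have r: "r k \<in> earring_sphere n k" "(\<exists>s \<in> earring_sphere n k. s \<notin> O') \<longrightarrow> r k \<notin> O'"
    if "k \<ge> 1" for k
  proof -
    have "\<exists>r. r \<in> earring_sphere n k \<and> ((\<exists>s \<in> earring_sphere n k. s \<notin> O') \<longrightarrow> r \<notin> O')"
      using earring_base_in_sphere[OF that] by blast
    from someI_ex[OF this] show "r k \<in> earring_sphere n k"
      "(\<exists>s \<in> earring_sphere n k. s \<notin> O') \<longrightarrow> r k \<notin> O'"
      by (simp_all add: r_def)
  qed
  have "((\<lambda>k. r k i) \<longlongrightarrow> 0) sequentially" for i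
  proof (rule Lim_null_comparison)
    show "\<forall>\<^sub>F k in sequentially. norm (r k i) \<le> 2 / real k"
      using eventually_ge_at_top[of 1]
      by eventually_elim (simp add: earring_sphere_coordinate_bound[OF _ r(1)])
  qed (rule lim_const_over_n)
  \<comment> \<open>The topology on sequences is the product topology, so coordinatewise convergence
    suffices.\<close>
  then have "limitin (powertop_real UNIV) r earring_base sequentially"
    by (simp add: limitin_componentwise earring_base_def)
  then have "\<forall>\<^sub>F k in sequentially. r k \<in> O'"
    using O' W by (auto simp: limitin_def euclidean_product_topology)
  then obtain K where K: "\<And>k. k \<ge> K \<Longrightarrow> r k \<in> O'"
    by (auto simp: eventually_sequentially)
  have "earring_tail n (max 1 K) \<subseteq> W"
    using r(2) K O'(2) by (auto simp: earring_tail_def) blast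
  then show thesis
    using that[of "max 1 K"] by simp
qed

section \<open>Identifying each sphere of the earring with the unit sphere\<close>

text \<open>
  The map \<open>r \<mapsto> e\<^sub>0 - k r\<close> rather than \<open>r \<mapsto> k r - e\<^sub>0\<close>, since the base point of the unit sphere
  is \<open>e\<^sub>0\<close>.
\<close>

definition earring_to_nsphere :: "nat \<Rightarrow> (nat \<Rightarrow> real) \<Rightarrow> nat \<Rightarrow> real" where
  "earring_to_nsphere k r = (\<lambda>i. nsphere_base i - real k * r i)"

definition nsphere_to_earring :: "nat \<Rightarrow> (nat \<Rightarrow> real) \<Rightarrow> nat \<Rightarrow> real" where
  "nsphere_to_earring k u = (\<lambda>i. (nsphere_base i - u i) / real k)"

lemma nsphere_to_earring_inverse:
  "k \<ge> 1 \<Longrightarrow> nsphere_to_earring k (earring_to_nsphere k r) = r"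
  by (simp add: earring_to_nsphere_def nsphere_to_earring_def)

lemma earring_to_nsphere_inverse:
  "k \<ge> 1 \<Longrightarrow> earring_to_nsphere k (nsphere_to_earring k u) = u"
  by (simp add: earring_to_nsphere_def nsphere_to_earring_def)

lemma earring_to_nsphere_base: "earring_to_nsphere k earring_base = nsphere_base"
  by (simp add: earring_to_nsphere_def earring_base_def)

lemma nsphere_to_earring_base: "nsphere_to_earring k nsphere_base = earring_base"
  by (simp add: nsphere_to_earring_def earring_base_def)

text \<open>The squared norm of \<open>e\<^sub>0 - k r\<close> is
  \<open>1 + k * (k * S - 2 * r 0)\<close> with \<open>S\<close> the sum of squares of
  \<open>r\<close>; it equals 1 exactly when the sphere equation holds.\<close>

lemma earring_to_nsphere_mem:
  assumes "k \<ge> 1"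
  shows "earring_to_nsphere k r \<in> topspace (nsphere n) \<longleftrightarrow> r \<in> earring_sphere n k"
proof -
  have split: "(\<Sum>i\<le>n. f i) = f 0 + (\<Sum>i=1..n. f i)" for f :: "nat \<Rightarrow> real"
    by (simp add: atMost_atLeast0 sum.atLeast_Suc_atMost)
  have "(\<Sum>i=1..n. (earring_to_nsphere k r i)\<^sup>2) = (real k)\<^sup>2 * (\<Sum>i=1..n. (r i)\<^sup>2)"
    unfolding sum_distrib_left
    by (rule sum.cong) (auto simp: earring_to_nsphere_def nsphere_base_def power_mult_distrib)
  then have "(\<Sum>i\<le>n. (earring_to_nsphere k r i)\<^sup>2) =
      1 + real k * (real k * (\<Sum>i\<le>n. (r i)\<^sup>2) - 2 * r 0)"
    unfolding split
    by (simp add: earring_to_nsphere_def nsphere_base_def power2_eq_square algebra_simps)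
  moreover have "(\<forall>i>n. earring_to_nsphere k r i = 0) \<longleftrightarrow> (\<forall>i>n. r i = 0)"
    using assms by (auto simp: earring_to_nsphere_def nsphere_base_def)
  ultimately show ?thesis
    using assms by (auto simp: nsphere_top_of_set mem_earring_sphere)
qed

lemma nsphere_to_earring_mem:
  assumes "k \<ge> 1" "u \<in> topspace (nsphere n)"
  shows "nsphere_to_earring k u \<in> earring_sphere n k"
  using assms earring_to_nsphere_mem[of k "nsphere_to_earring k u" n]
  by (simp add: earring_to_nsphere_inverse)

lemma continuous_map_earring_to_nsphere:
  assumes "k \<ge> 1"
  shows "continuous_map (subtopology (hawaiian_earring n) (earring_sphere n k)) (nsphere n)
    (earring_to_nsphere k)"
proof -
  have "continuous_on S (earring_to_nsphere k)" for S
    unfolding earring_to_nsphere_def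
    by (intro continuous_intros continuous_on_component)
  moreover have "subtopology (hawaiian_earring n) (earring_sphere n k)
      = top_of_set (earring_sphere n k)"
    using earring_sphere_subset[OF assms, of n]
    by (simp add: hawaiian_earring_top_of_set subtopology_subtopology Int_absorb1)
  ultimately show ?thesis
    using earring_to_nsphere_mem[OF assms, of _ n]
    by (auto simp: nsphere_top_of_set)
qed

lemma continuous_map_nsphere_to_earring:
  assumes "k \<ge> 1"
  shows "continuous_map (nsphere n) (hawaiian_earring n) (nsphere_to_earring k)"
proof -
  have "continuous_on S (nsphere_to_earring k)" for S
    unfolding nsphere_to_earring_def using assms
    by (intro continuous_intros continuous_on_component) auto
  moreover have "nsphere_to_earring k u \<in> earring_tail n 1" if "u \<in> topspace (nsphere n)" for u
    using nsphere_to_earring_mem[OF assms that] earring_sphere_subset[OF assms] by blast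
  ultimately show ?thesis
    by (auto simp: nsphere_top_of_set hawaiian_earring_top_of_set)
qed

section \<open>Extending loops to the earring and deforming maps on it\<close>

text \<open>The first sphere and the tail from 2 on are closed, cover the earring and meet only in
  the base point, where the transported loop and the constant agree; hence the two maps can be
  pasted.\<close>

lemma n_loop_extends_to_earring:
  assumes "n_loop n X x \<alpha>"
  obtains f where "hawaiian_map n X x f"
    "\<And>u. u \<in> topspace (nsphere n) \<Longrightarrow> f (nsphere_to_earring 1 u) = \<alpha> u"
proof -
  have \<alpha>: "continuous_map (nsphere n) X \<alpha>" "\<alpha> nsphere_base = x"
    using assms by (auto simp: n_loop_def)
  \<comment> \<open>This yields \<open>x \<in> topspace X\<close>, which continuity of the constant
    map on the tail requires.\<close>
  have "nsphere_base \<in> topspace (nsphere n)"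
    using earring_to_nsphere_mem[of 1 earring_base n] earring_base_in_sphere
    by (simp add: earring_to_nsphere_base)
  then have x: "x \<in> topspace X"
    using \<alpha> continuous_map_image_subset_topspace by blast
  define T where "T i = (if i = 1 then earring_sphere n 1 else earring_tail n 2)" for i :: nat
  define g where "g i = (if i = 1 then \<alpha> \<circ> earring_to_nsphere 1 else (\<lambda>r. x))" for i :: nat
  have base: "g i r = x" if "r = earring_base" for i r
    using that \<alpha> by (simp add: g_def earring_to_nsphere_base)
  have meet: "r = earring_base" if "r \<in> earring_sphere n 1" "r \<in> earring_tail n 2" for r
    using that earring_sphere_inter_tail[of 1 2] by simp
  have cover: "earring_tail n 1 = earring_sphere n 1 \<union> earring_tail n 2"
    using earring_tail_unfold[of n 1] by (simp add: numeral_2_eq_2)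
  obtain f where f: "continuous_map (hawaiian_earring n) X f"
      "\<And>r i. i \<in> {1,2} \<Longrightarrow> r \<in> topspace (hawaiian_earring n) \<inter> T i \<Longrightarrow> f r = g i r"
  proof (rule pasting_lemma_exists_closed[of "{1,2}" "hawaiian_earring n" T X g])
    show "topspace (hawaiian_earring n) \<subseteq> \<Union> (T ` {1, 2})"
      using cover by (auto simp: topspace_hawaiian_earring T_def)
    show "closedin (hawaiian_earring n) (T i)" if "i \<in> {1,2}" for i
      using that by (auto simp: T_def closedin_earring_sphere closedin_earring_tail)
    show "continuous_map (subtopology (hawaiian_earring n) (T i)) X (g i)" if "i \<in> {1,2}" for i
      using that x continuous_map_compose[OF continuous_map_earring_to_nsphere[of 1 n] \<alpha>(1)]
      by (auto simp: T_def g_def)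
    show "g i r = g j r" if "i \<in> {1,2}" "j \<in> {1,2}"
      "r \<in> topspace (hawaiian_earring n) \<inter> T i \<inter> T j" for i j r
      using that base meet by (cases "i = j") (force simp: T_def)+
  qed auto
  have "f r = g 1 r" if "r \<in> earring_sphere n 1" for r
    using f(2)[of 1 r] that cover by (auto simp: T_def topspace_hawaiian_earring)
  then have *: "f r = \<alpha> (earring_to_nsphere 1 r)" if "r \<in> earring_sphere n 1" for r
    using that by (simp add: g_def)
  show thesis
  proof
    show "hawaiian_map n X x f"
      using f(1) * \<alpha> by (simp add: hawaiian_map_def earring_base_in_sphere earring_to_nsphere_base)
    show "f (nsphere_to_earring 1 u) = \<alpha> u" if "u \<in> topspace (nsphere n)" for u
      using *[OF nsphere_to_earring_mem[OF order_refl that]] by (simp add: earring_to_nsphere_inverse)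
  qed
qed

text \<open>The homotopy moves the spheres below some index \<open>K\<close> all at once and is
  stationary on the tail from \<open>K\<close> on, which \<open>f\<close> already maps into
  \<open>V\<close>. Finiteness matters: infinitely many homotopies, chosen independently, might not
  fit together continuously at the base point.\<close>

lemma hawaiian_map_homotopic_into_open:
  assumes small: "\<And>\<alpha>. n_loop n X x \<alpha> \<Longrightarrow> small_n_loop n X x \<alpha>"
    and V: "openin X V" "x \<in> V" and f: "hawaiian_map n X x f"
  obtains g where "hawaiian_map n X x g" "g ` topspace (hawaiian_earring n) \<subseteq> V"
    "homotopic_with (\<lambda>h. h earring_base = x) (hawaiian_earring n) X f g"
proof -
  let ?H = "hawaiian_earring n" and ?I = "top_of_set {0..1::real}"
  have fc: "continuous_map ?H X f" and fb: "f earring_base = x"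
    using f by (auto simp: hawaiian_map_def)
  have base: "earring_base \<in> earring_tail n 1"
    using earring_sphere_subset earring_base_in_sphere by blast
  obtain K where K: "K \<ge> 1" "earring_tail n K \<subseteq> {r \<in> topspace ?H. f r \<in> V}"
  proof (rule earring_tail_subset_open)
    show "openin ?H {r \<in> topspace ?H. f r \<in> V}"
      using openin_continuous_map_preimage[OF fc V(1)] .
  qed (use V base fb topspace_hawaiian_earring in auto)
  \<comment> \<open>Smallness of the restriction of \<open>f\<close> to the \<open>k\<close>-th
    sphere, with the homotopy made explicit and the final loop recorded only through its values in
    \<open>V\<close>.\<close>
  have "\<exists>h. continuous_map (prod_topology ?I (nsphere n)) X h \<and>
      (\<forall>u. h (0, u) = f (nsphere_to_earring k u)) \<and>
      (\<forall>u\<in>topspace (nsphere n). h (1, u) \<in> V) \<and> (\<forall>t\<in>{0..1}. h (t, nsphere_base) = x)"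
    if "k \<ge> 1" for k
  proof -
    have "n_loop n X x (f \<circ> nsphere_to_earring k)"
      using continuous_map_compose[OF continuous_map_nsphere_to_earring[OF that] fc] fb
      by (simp add: n_loop_def nsphere_to_earring_base)
    from small[OF this] V obtain \<beta> where \<beta>: "\<beta> ` topspace (nsphere n) \<subseteq> V"
      "homotopic_with (\<lambda>h. h nsphere_base = x) (nsphere n) X (f \<circ> nsphere_to_earring k) \<beta>"
      unfolding small_n_loop_def by blast
    then show ?thesis
      unfolding homotopic_with_def by (force simp: image_subset_iff)
  qed
  then obtain h where hc: "\<And>k. k \<ge> 1 \<Longrightarrow> continuous_map (prod_topology ?I (nsphere n)) X (h k)"
    and h0: "\<And>k u. k \<ge> 1 \<Longrightarrow> h k (0, u) = f (nsphere_to_earring k u)"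
    and h1: "\<And>k u. k \<ge> 1 \<Longrightarrow> u \<in> topspace (nsphere n) \<Longrightarrow> h k (1, u) \<in> V"
    and hb: "\<And>k t. k \<ge> 1 \<Longrightarrow> t \<in> {0..1} \<Longrightarrow> h k (t, nsphere_base) = x"
    by metis
  \<comment> \<open>The indices in \<open>{1..K}\<close> name the pieces: those below
    \<open>K\<close> are single spheres, and \<open>K\<close> itself stands for the tail.\<close>
  define T where "T k = (if k < K then earring_sphere n k else earring_tail n K)" for k
  define G where "G k p = (if k < K then h k (fst p, earring_to_nsphere k (snd p)) else f (snd p))"
    for k and p :: "real \<times> (nat \<Rightarrow> real)"
  have base_eq: "G k (t, earring_base) = x" if "k \<ge> 1" "t \<in> {0..1}" for k t
    using that hb fb by (simp add: G_def earring_to_nsphere_base)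
  have meet: "r = earring_base"
    if "i \<in> {1..K}" "j \<in> {1..K}" "r \<in> T i" "r \<in> T j" "i \<noteq> j" for i j r
    using that earring_spheres_meet[of i j r n] earring_sphere_inter_tail[of _ K r n]
    by (auto simp: T_def split: if_splits)
  have cover: "\<exists>k\<in>{1..K}. r \<in> T k" if "r \<in> earring_tail n 1" for r
  proof -
    obtain k where "k \<ge> 1" "r \<in> earring_sphere n k"
      using \<open>r \<in> earring_tail n 1\<close> by (auto simp: earring_tail_def)
    then show ?thesis
      \<comment> \<open>Every sphere of index at least \<open>K\<close> belongs to the piece with
        index \<open>K\<close>.\<close>
      using K(1) by (intro bexI[of _ "min k K"]) (auto simp: T_def earring_tail_def min_def)
  qed
  obtain F where Fc: "continuous_map (prod_topology ?I ?H) X F"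
    and F: "\<And>p k. k \<in> {1..K} \<Longrightarrow> p \<in> topspace (prod_topology ?I ?H) \<inter> {0..1} \<times> T k \<Longrightarrow> F p = G k p"
  \<comment> \<open>Pasting over a finite closed cover of the cylinder. Distinct pieces overlap only
    in the segment over the base point, where every \<open>G k\<close> has the value
    \<open>x\<close>.\<close>
  proof (rule pasting_lemma_exists_closed
      [of "{1..K}" "prod_topology ?I ?H" "\<lambda>k. {0..1} \<times> T k" X G])
    show "topspace (prod_topology ?I ?H) \<subseteq> (\<Union>k\<in>{1..K}. {0..1} \<times> T k)"
      using cover by (force simp: topspace_hawaiian_earring)
    show "closedin (prod_topology ?I ?H) ({0..1} \<times> T k)" if "k \<in> {1..K}" for k
      using that closedin_topspace[of ?I] K(1)
      by (auto simp: closedin_prod_Times_iff T_def closedin_earring_sphere closedin_earring_tail)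
    show "continuous_map (subtopology (prod_topology ?I ?H) ({0..1} \<times> T k)) X (G k)"
      if "k \<in> {1..K}" for k
    proof (cases "k < K")
      case True
      have k: "k \<ge> 1" using that by simp
      have "continuous_map (prod_topology ?I (subtopology ?H (earring_sphere n k)))
          (prod_topology ?I (nsphere n)) (\<lambda>p. (fst p, earring_to_nsphere k (snd p)))"
        by (intro continuous_map_pairedI continuous_map_fst
            continuous_map_compose[OF continuous_map_snd continuous_map_earring_to_nsphere[OF k],
              unfolded o_def])
      moreover have "G k = h k \<circ> (\<lambda>p. (fst p, earring_to_nsphere k (snd p)))"
        using True by (simp add: G_def fun_eq_iff)
      ultimately show ?thesis
        using continuous_map_compose[OF _ hc[OF k]] True
        by (simp add: subtopology_Times subtopology_subtopology T_def)
    next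
      case False
      have "continuous_map (prod_topology ?I ?H) X (\<lambda>p. f (snd p))"
        using continuous_map_compose[OF continuous_map_snd fc] by (simp add: o_def)
      moreover have "G k = (\<lambda>p. f (snd p))"
        using False by (simp add: G_def fun_eq_iff)
      ultimately show ?thesis
        by (simp add: continuous_map_from_subtopology)
    qed
    show "G i p = G j p" if "i \<in> {1..K}" "j \<in> {1..K}"
      "p \<in> topspace (prod_topology ?I ?H) \<inter> {0..1} \<times> T i \<inter> {0..1} \<times> T j" for i j p
    proof (cases "i = j")
      case False
      obtain t r where p: "p = (t, r)" by (cases p)
      with that have "t \<in> {0..1}" "r \<in> T i" "r \<in> T j" by auto
      with meet[OF that(1,2) _ _ False] have "r = earring_base" by blast
      with \<open>t \<in> {0..1}\<close> base_eq[of i t] base_eq[of j t] that(1,2) p show ?thesis by simp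
    qed simp
  qed auto
  have F': "F (t, r) = G k (t, r)" if "k \<in> {1..K}" "t \<in> {0..1}" "r \<in> earring_tail n 1" "r \<in> T k"
    for k t r
    using that F[of k "(t, r)"] by (simp add: topspace_hawaiian_earring)
  have F0: "F (0, r) = f r" if r: "r \<in> topspace ?H" for r
  proof -
    obtain k where "k \<in> {1..K}" "r \<in> T k"
      using r cover[of r] unfolding topspace_hawaiian_earring by blast
    then show ?thesis
      using that F'[of k 0 r] h0[of k]
      by (auto simp: topspace_hawaiian_earring G_def nsphere_to_earring_inverse)
  qed
  have F1: "F (1, r) \<in> V" if r: "r \<in> topspace ?H" for r
  proof -
    obtain k where k: "k \<in> {1..K}" "r \<in> T k"
      using r cover[of r] unfolding topspace_hawaiian_earring by blast
    then have "G k (1, r) \<in> V"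
      using h1[of k "earring_to_nsphere k r"] K(2)
      by (auto simp: G_def T_def earring_to_nsphere_mem split: if_splits)
    then show ?thesis
      using k that F'[of k 1 r] by (simp add: topspace_hawaiian_earring)
  qed
  have Fb: "F (t, earring_base) = x" if "t \<in> {0..1}" for t
  proof -
    obtain k where "k \<in> {1..K}" "earring_base \<in> T k"
      using base cover by blast
    then show ?thesis
      using that base F'[of k t earring_base] base_eq by simp
  qed
  show thesis
  proof
    have "continuous_map ?H X (F \<circ> (\<lambda>r. (1, r)))"
      by (rule continuous_map_compose[OF _ Fc]) (simp add: continuous_map_pairwise o_def)
    then show "hawaiian_map n X x (\<lambda>r. F (1, r))"
      using Fb by (simp add: hawaiian_map_def o_def)
    show "(\<lambda>r. F (1, r)) ` topspace ?H \<subseteq> V"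
      using F1 by blast
    show "homotopic_with (\<lambda>h. h earring_base = x) ?H X f (\<lambda>r. F (1, r))"
    \<comment> \<open>This characterisation asks for agreement at time 0 only on the earring, which
      is all that \<open>F0\<close> provides. Its side condition, case 1, holds because the base
      point lies on the earring.\<close>
    proof (rule iffD2[OF homotopic_with], goal_cases)
      case (1 k l)
      then show ?case
        using base by (simp add: topspace_hawaiian_earring)
    next
      case 2
      show ?case
        using Fc F0 Fb by blast
    qed
  qed
qed

section \<open>Homotopy classes and induced maps\<close>

lemma hawaiian_class_eq:
  assumes "homotopic_with (\<lambda>h. h earring_base = x) (hawaiian_earring n) X f g"
  shows "hawaiian_class n X x f = hawaiian_class n X x g"
  using assms unfolding hawaiian_class_def
  by (blast intro: homotopic_with_trans homotopic_with_symD)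

lemma hawaiian_map_compose:
  assumes "hawaiian_map n X x f" "continuous_map X Y \<beta>" "\<beta> x = y"
  shows "hawaiian_map n Y y (\<beta> \<circ> f)"
  using assms by (auto simp: hawaiian_map_def intro: continuous_map_compose)

text \<open>The common frame of both group equalities: with \<open>\<beta>\<close> the inclusion of
  the smaller wedge, or of \<open>X1\<close>, only lifting maps up to homotopy remains to be shown.
  The homotopy may run through all of \<open>X\<close>.\<close>

lemma hawaiian_induced_surjective:
  assumes \<beta>: "continuous_map Z X \<beta>" "\<beta> z = x"
    and lift: "\<And>f. hawaiian_map n X x f \<Longrightarrow> \<exists>g. hawaiian_map n Z z g \<and>
      homotopic_with (\<lambda>h. h earring_base = x) (hawaiian_earring n) X f (\<beta> \<circ> g)"
  shows "carrier (hawaiian_group n X x) =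
    hawaiian_induced n X x \<beta> ` carrier (hawaiian_group n Z z)"
proof
  show "carrier (hawaiian_group n X x) \<subseteq>
      hawaiian_induced n X x \<beta> ` carrier (hawaiian_group n Z z)"
  proof
    fix A assume "A \<in> carrier (hawaiian_group n X x)"
    then obtain f where f: "hawaiian_map n X x f" "A = hawaiian_class n X x f"
      by (auto simp: hawaiian_group_def)
    then obtain g where g: "hawaiian_map n Z z g"
        "homotopic_with (\<lambda>h. h earring_base = x) (hawaiian_earring n) X f (\<beta> \<circ> g)"
      using lift by blast
    have "A = hawaiian_induced n X x \<beta> (hawaiian_class n Z z g)"
      using hawaiian_induced_class[OF g(1) \<beta>] hawaiian_class_eq[OF g(2)] f by simp
    then show "A \<in> hawaiian_induced n X x \<beta> ` carrier (hawaiian_group n Z z)"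
      using g(1) by (auto simp: hawaiian_group_def)
  qed
  show "hawaiian_induced n X x \<beta> ` carrier (hawaiian_group n Z z)
      \<subseteq> carrier (hawaiian_group n X x)"
    using hawaiian_map_compose[OF _ \<beta>] hawaiian_induced_class[OF _ \<beta>]
    by (auto simp: hawaiian_group_def)
qed

section \<open>Open sets of the wedge and maps into it\<close>

text \<open>The inclusion is \<open>id\<close> because both wedges use the same representatives in
  the sum type. The smaller one carries its own quotient topology; the traces of an open set on its
  summands are the old traces cut down to \<open>U1\<close> and \<open>U2\<close>.\<close>

lemma continuous_map_wedge_subtopology:
  "continuous_map (wedge (subtopology X1 U1) x1 (subtopology X2 U2) x2) (wedge X1 x1 X2 x2) id"
proof -
  let ?q = "wedge_proj x1 x2"
  let ?Z = "wedge (subtopology X1 U1) x1 (subtopology X2 U2) x2"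
  have "openin ?Z {z \<in> topspace ?Z. z \<in> W}" if "openin (wedge X1 x1 X2 x2) W" for W
  proof -
    have W: "openin X1 {a \<in> topspace X1. ?q (Inl a) \<in> W}"
      "openin X2 {b \<in> topspace X2. ?q (Inr b) \<in> W}"
      using that by (auto simp: openin_wedge)
    have "{a \<in> topspace (subtopology X1 U1). ?q (Inl a) \<in> {z \<in> topspace ?Z. z \<in> W}} =
        {a \<in> topspace X1. ?q (Inl a) \<in> W} \<inter> U1"
      "{b \<in> topspace (subtopology X2 U2). ?q (Inr b) \<in> {z \<in> topspace ?Z. z \<in> W}} =
        {b \<in> topspace X2. ?q (Inr b) \<in> W} \<inter> U2"
      by (auto simp: topspace_wedge)
    then show ?thesis
      using W unfolding openin_wedge[of "subtopology X1 U1"] openin_subtopology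
      by (auto simp: topspace_wedge)
  qed
  moreover have "topspace ?Z \<subseteq> topspace (wedge X1 x1 X2 x2)"
    by (auto simp: topspace_wedge)
  ultimately show ?thesis
    by (auto simp: continuous_map_def)
qed

lemma continuous_map_Inl_wedge: "continuous_map X1 (wedge X1 x1 X2 x2) Inl"
proof -
  have "openin X1 {a \<in> topspace X1. Inl a \<in> W}" if "openin (wedge X1 x1 X2 x2) W" for W
    using that by (simp add: openin_wedge wedge_proj_def)
  moreover have "Inl a \<in> topspace (wedge X1 x1 X2 x2)" if "a \<in> topspace X1" for a
    using that by (force simp: topspace_wedge wedge_proj_def)
  ultimately show ?thesis
    by (auto simp: continuous_map_def)
qed

text \<open>Since both base points are included, the gluing adds no point to either side: the traces
  on the summands are exactly \<open>V1\<close> and \<open>V2\<close>.\<close>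

lemma openin_wedge_neighbourhoods:
  assumes "openin X1 V1" "x1 \<in> V1" "openin X2 V2" "x2 \<in> V2"
  shows "openin (wedge X1 x1 X2 x2) (wedge_proj x1 x2 ` (V1 <+> V2))"
proof -
  have sub: "V1 \<subseteq> topspace X1" "V2 \<subseteq> topspace X2"
    using assms openin_subset by auto
  then have "{a \<in> topspace X1. wedge_proj x1 x2 (Inl a) \<in> wedge_proj x1 x2 ` (V1 <+> V2)} = V1"
    "{b \<in> topspace X2. wedge_proj x1 x2 (Inr b) \<in> wedge_proj x1 x2 ` (V1 <+> V2)} = V2"
    using assms by (auto simp: wedge_proj_def Plus_def image_iff split: if_splits)
  then show ?thesis
    using assms sub by (auto simp: openin_wedge)
qed

text \<open>An open set of the smaller wedge has traces that are only relatively open in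
  \<open>U1\<close> and \<open>U2\<close>. Intersecting it with the image of
  \<open>V1 <+> V2\<close> makes it open in the large wedge and leaves its preimage under
  \<open>g\<close> unchanged.\<close>

lemma continuous_map_into_wedge_subtopology:
  assumes V1: "openin X1 V1" "x1 \<in> V1" "V1 \<subseteq> U1" and V2: "openin X2 V2" "x2 \<in> V2" "V2 \<subseteq> U2"
    and g: "continuous_map Y (wedge X1 x1 X2 x2) g"
    and im: "g ` topspace Y \<subseteq> wedge_proj x1 x2 ` (V1 <+> V2)"
  shows "continuous_map Y (wedge (subtopology X1 U1) x1 (subtopology X2 U2) x2) g"
proof -
  let ?q = "wedge_proj x1 x2"
  let ?Z = "wedge (subtopology X1 U1) x1 (subtopology X2 U2) x2"
  let ?V = "?q ` (V1 <+> V2)"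
  have sub: "V1 \<subseteq> topspace X1" "V2 \<subseteq> topspace X2"
    using openin_subset[OF V1(1)] openin_subset[OF V2(1)] by simp_all
  have "openin Y {y \<in> topspace Y. g y \<in> W}" if W: "openin ?Z W" for W
  proof -
    obtain O1 O2 where O1: "openin X1 O1" "{a \<in> topspace X1 \<inter> U1. ?q (Inl a) \<in> W} = O1 \<inter> U1"
      and O2: "openin X2 O2" "{b \<in> topspace X2 \<inter> U2. ?q (Inr b) \<in> W} = O2 \<inter> U2"
      using W by (auto simp: openin_wedge openin_subtopology)
    have V: "openin (wedge X1 x1 X2 x2) ?V"
      using V1 V2 by (simp add: openin_wedge_neighbourhoods)
    have pre: "{a \<in> topspace X1. ?q (Inl a) \<in> ?V} = V1" "{b \<in> topspace X2. ?q (Inr b) \<in> ?V} = V2"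
      using V1 V2 sub by (auto simp: wedge_proj_def Plus_def image_iff split: if_splits)
    have "{a \<in> topspace X1. ?q (Inl a) \<in> W \<inter> ?V} = O1 \<inter> V1"
      using pre(1) O1(2) V1(3) sub by blast
    moreover have "{b \<in> topspace X2. ?q (Inr b) \<in> W \<inter> ?V} = O2 \<inter> V2"
      using pre(2) O2(2) V2(3) sub by blast
    ultimately have "openin (wedge X1 x1 X2 x2) (W \<inter> ?V)"
      using O1(1) O2(1) V1(1) V2(1) V by (simp add: openin_wedge openin_Int le_infI2)
    from openin_continuous_map_preimage[OF g this]
    have "openin Y {y \<in> topspace Y. g y \<in> W \<inter> ?V}" .
    moreover have "{y \<in> topspace Y. g y \<in> W \<inter> ?V} = {y \<in> topspace Y. g y \<in> W}"
      using im by blast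
    ultimately show ?thesis by simp
  qed
  moreover have "g ` topspace Y \<subseteq> topspace ?Z"
  proof -
    have "?V \<subseteq> topspace ?Z"
      unfolding topspace_wedge using sub V1 V2 by (intro image_mono) auto
    with im show ?thesis by (rule order_trans)
  qed
  ultimately show ?thesis
    by (simp add: continuous_map_def image_subset_iff_funcset)
qed

text \<open>As \<open>W\<close> misses \<open>x1\<close>, the set does not contain the glued point,
  so its trace on \<open>X2\<close> is empty.\<close>

lemma openin_wedge_Inl:
  assumes "openin X1 W" "x1 \<notin> W"
  shows "openin (wedge X1 x1 X2 x2) (Inl ` W)"
proof -
  have "W \<subseteq> topspace X1"
    using assms openin_subset by auto
  then have eq: "{a \<in> topspace X1. wedge_proj x1 x2 (Inl a) \<in> Inl ` W} = W"
    "{b \<in> topspace X2. wedge_proj x1 x2 (Inr b) \<in> Inl ` W} = {}"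
    "Inl ` W \<subseteq> wedge_proj x1 x2 ` (topspace X1 <+> topspace X2)"
    using assms(2) by (auto simp: wedge_proj_def image_iff)
  show ?thesis
    unfolding openin_wedge eq(1,2) using assms(1) eq(3) by simp
qed

text \<open>On the image of \<open>g\<close>, \<open>projl\<close> inverts \<open>Inl\<close>. An
  open \<open>W\<close> may contain \<open>x1\<close>, but \<open>W \<inter> V\<close> does not, so
  \<open>Inl\<close> maps it to an open set with the same preimage under \<open>g\<close>.\<close>

lemma continuous_map_projl_wedge:
  assumes g: "continuous_map Y (wedge X1 x1 X2 x2) g"
    and V: "openin X1 V" "x1 \<notin> V" and im: "g ` topspace Y \<subseteq> Inl ` V"
  shows "continuous_map Y X1 (projl \<circ> g)"
proof -
  have "openin Y {y \<in> topspace Y. (projl \<circ> g) y \<in> W}" if W: "openin X1 W" for W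
  proof -
    have "openin (wedge X1 x1 X2 x2) (Inl ` (W \<inter> V))"
      using W V by (intro openin_wedge_Inl) auto
    from openin_continuous_map_preimage[OF g this]
    have "openin Y {y \<in> topspace Y. g y \<in> Inl ` (W \<inter> V)}" .
    moreover have "{y \<in> topspace Y. g y \<in> Inl ` (W \<inter> V)} = {y \<in> topspace Y. (projl \<circ> g) y \<in> W}"
    proof (rule Collect_cong, rule conj_cong[OF refl])
      fix y assume "y \<in> topspace Y"
      then obtain v where "v \<in> V" "g y = Inl v"
        using im by blast
      then show "g y \<in> Inl ` (W \<inter> V) \<longleftrightarrow> (projl \<circ> g) y \<in> W"
        by auto
    qed
    ultimately show ?thesis by simp
  qed
  moreover have "(projl \<circ> g) y \<in> topspace X1" if y: "y \<in> topspace Y" for y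
  proof -
    obtain v where "v \<in> V" "g y = Inl v"
      using im y by blast
    then show ?thesis
      using openin_subset[OF V(1)] by auto
  qed
  ultimately show ?thesis
    by (auto simp: continuous_map_def)
qed

section \<open>The two directions of (i), and (ii)\<close>

lemma hawaiian_group_eq_neighbourhoods_if_small:
  fixes X1 :: "'a topology" and X2 :: "'b topology" and x1 :: 'a and x2 :: 'b
  defines "X \<equiv> wedge X1 x1 X2 x2"
  assumes small: "\<And>\<alpha>. n_loop n X (Inl x1) \<alpha> \<Longrightarrow> small_n_loop n X (Inl x1) \<alpha>"
    and U: "neighbourhood_in X1 x1 U1" "neighbourhood_in X2 x2 U2"
  shows "carrier (hawaiian_group n X (Inl x1)) = hawaiian_induced n X (Inl x1) id `
    carrier (hawaiian_group n (wedge (subtopology X1 U1) x1 (subtopology X2 U2) x2) (Inl x1))"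
proof (rule hawaiian_induced_surjective)
  let ?Z = "wedge (subtopology X1 U1) x1 (subtopology X2 U2) x2"
  show "continuous_map ?Z X id"
    unfolding X_def by (rule continuous_map_wedge_subtopology)
  show "id (Inl x1) = (Inl x1 :: 'a + 'b)" by simp
  \<comment> \<open>The given neighbourhoods need not be open, so the deformation aims at open sets
    inside them.\<close>
  obtain V1 V2 where V1: "openin X1 V1" "x1 \<in> V1" "V1 \<subseteq> U1"
    and V2: "openin X2 V2" "x2 \<in> V2" "V2 \<subseteq> U2"
    using U unfolding neighbourhood_in_def by blast
  let ?V = "wedge_proj x1 x2 ` (V1 <+> V2)"
  have V: "openin X ?V"
    unfolding X_def using V1 V2 by (simp add: openin_wedge_neighbourhoods)
  have b: "Inl x1 \<in> ?V"
    using V1 by (force simp: wedge_proj_def)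
  show "\<exists>g. hawaiian_map n ?Z (Inl x1) g \<and>
      homotopic_with (\<lambda>h. h earring_base = Inl x1) (hawaiian_earring n) X f (id \<circ> g)"
    if f: "hawaiian_map n X (Inl x1) f" for f
  proof -
    obtain g where g: "hawaiian_map n X (Inl x1) g" "g ` topspace (hawaiian_earring n) \<subseteq> ?V"
      "homotopic_with (\<lambda>h. h earring_base = Inl x1) (hawaiian_earring n) X f g"
      using hawaiian_map_homotopic_into_open[OF small V b f] by blast
    then have "hawaiian_map n ?Z (Inl x1) g"
      using continuous_map_into_wedge_subtopology[OF V1 V2 _ g(2)]
      by (simp add: hawaiian_map_def X_def)
    with g(3) show ?thesis by auto
  qed
qed

text \<open>For an open \<open>U\<close> the equality is applied to the traces of \<open>U\<close>
  on the two summands. It makes the extended loop homotopic to a map into \<open>U\<close>, and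
  restricting that homotopy to the first sphere deforms \<open>\<alpha>\<close> into
  \<open>U\<close>.\<close>

lemma small_n_loop_if_hawaiian_group_eq_neighbourhoods:
  fixes X1 :: "'a topology" and X2 :: "'b topology" and x1 :: 'a and x2 :: 'b
  defines "X \<equiv> wedge X1 x1 X2 x2"
  assumes x: "x1 \<in> topspace X1" "x2 \<in> topspace X2"
    and eq: "\<And>U1 U2. neighbourhood_in X1 x1 U1 \<Longrightarrow> neighbourhood_in X2 x2 U2 \<Longrightarrow>
      carrier (hawaiian_group n X (Inl x1)) = hawaiian_induced n X (Inl x1) id `
        carrier (hawaiian_group n (wedge (subtopology X1 U1) x1 (subtopology X2 U2) x2) (Inl x1))"
    and \<alpha>: "n_loop n X (Inl x1) \<alpha>"
  shows "small_n_loop n X (Inl x1) \<alpha>"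
proof -
  let ?q = "wedge_proj x1 x2"
  have "\<exists>\<beta>. n_loop n X (Inl x1) \<beta> \<and> \<beta> ` topspace (nsphere n) \<subseteq> U \<and>
      homotopic_with (\<lambda>h. h nsphere_base = Inl x1) (nsphere n) X \<alpha> \<beta>"
    if U: "openin X U" "Inl x1 \<in> U" for U
  proof -
    define U1 where "U1 = {a \<in> topspace X1. ?q (Inl a) \<in> U}"
    define U2 where "U2 = {b \<in> topspace X2. ?q (Inr b) \<in> U}"
    let ?Z = "wedge (subtopology X1 U1) x1 (subtopology X2 U2) x2"
    have "openin X1 U1" "openin X2 U2"
      using U by (auto simp: X_def openin_wedge U1_def U2_def)
    moreover have "x1 \<in> U1" "x2 \<in> U2"
      using U x by (auto simp: U1_def U2_def wedge_proj_def)
    ultimately have nb: "neighbourhood_in X1 x1 U1" "neighbourhood_in X2 x2 U2"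
      using openin_subset unfolding neighbourhood_in_def by blast+
    obtain f where f: "hawaiian_map n X (Inl x1) f"
      "\<And>u. u \<in> topspace (nsphere n) \<Longrightarrow> f (nsphere_to_earring 1 u) = \<alpha> u"
      using n_loop_extends_to_earring[OF \<alpha>] by blast
    have "hawaiian_class n X (Inl x1) f \<in> carrier (hawaiian_group n X (Inl x1))"
      using f(1) by (auto simp: hawaiian_group_def)
    then obtain g where g: "hawaiian_map n ?Z (Inl x1) g"
      "hawaiian_class n X (Inl x1) f =
        hawaiian_induced n X (Inl x1) id (hawaiian_class n ?Z (Inl x1) g)"
      unfolding eq[OF nb] by (auto simp: hawaiian_group_def)
    have j: "continuous_map ?Z X id"
      unfolding X_def by (rule continuous_map_wedge_subtopology)
    have "hawaiian_class n X (Inl x1) f = hawaiian_class n X (Inl x1) g"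
      using g(2) hawaiian_induced_class[OF g(1) j] by simp
    moreover have gX: "hawaiian_map n X (Inl x1) g"
      using hawaiian_map_compose[OF g(1) j] by simp
    \<comment> \<open>Equal classes give a homotopy because \<open>g\<close>, being continuous into
      \<open>X\<close> with the right base value, lies in its own class.\<close>
    ultimately have hom: "homotopic_with (\<lambda>h. h earring_base = Inl x1) (hawaiian_earring n) X f g"
      by (auto simp: hawaiian_class_def hawaiian_map_def)
    let ?\<beta> = "g \<circ> nsphere_to_earring 1" and ?s = "nsphere_to_earring 1"
    have s: "continuous_map (nsphere n) (hawaiian_earring n) ?s"
      by (simp add: continuous_map_nsphere_to_earring)
    have "homotopic_with (\<lambda>h. h nsphere_base = Inl x1) (nsphere n) X (f \<circ> ?s) ?\<beta>"
      by (rule homotopic_with_compose_continuous_map_right[OF hom s])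
        (simp add: nsphere_to_earring_base)
    \<comment> \<open>The two loops agree only on the sphere, hence a homotopy rather than an
      equation.\<close>
    moreover have "homotopic_with (\<lambda>h. h nsphere_base = Inl x1) (nsphere n) X \<alpha> (f \<circ> ?s)"
      using \<alpha> f by (intro homotopic_with_equal)
        (auto simp: n_loop_def hawaiian_map_def nsphere_to_earring_base)
    ultimately have "homotopic_with (\<lambda>h. h nsphere_base = Inl x1) (nsphere n) X \<alpha> ?\<beta>"
      by (rule homotopic_with_trans[rotated])
    moreover have "n_loop n X (Inl x1) ?\<beta>"
      using gX continuous_map_compose[OF s, of X g]
      by (simp add: n_loop_def hawaiian_map_def nsphere_to_earring_base)
    moreover have "?\<beta> ` topspace (nsphere n) \<subseteq> U"
    proof -
      have "?\<beta> ` topspace (nsphere n) \<subseteq> topspace ?Z"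
        using continuous_map_compose[OF s] g(1) continuous_map_image_subset_topspace
        unfolding hawaiian_map_def by blast
      also have "topspace ?Z \<subseteq> U"
        by (auto simp: topspace_wedge U1_def U2_def)
      finally show ?thesis .
    qed
    ultimately show ?thesis by blast
  qed
  with \<alpha> show ?thesis
    by (auto simp: small_n_loop_def)
qed

lemma hawaiian_group_wedge_eq_summand:
  fixes X1 :: "'a topology" and X2 :: "'b topology" and x1 :: 'a and x2 :: 'b
  defines "X \<equiv> wedge X1 x1 X2 x2"
  assumes closed: "closedin X1 {x1}" and x: "x \<in> topspace X1" "x \<noteq> x1"
    and small: "\<And>\<alpha>. n_loop n X (Inl x) \<alpha> \<Longrightarrow> small_n_loop n X (Inl x) \<alpha>"
  shows "carrier (hawaiian_group n X (Inl x)) =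
    hawaiian_induced n X (Inl x) Inl ` carrier (hawaiian_group n X1 x)"
proof (rule hawaiian_induced_surjective)
  show "continuous_map X1 X Inl"
    unfolding X_def by (rule continuous_map_Inl_wedge)
  show "Inl x = (Inl x :: 'a + 'b)" ..
  \<comment> \<open>Closedness of \<open>{x1}\<close> makes this set open, and
    \<open>x \<noteq> x1\<close> puts \<open>x\<close> into it.\<close>
  define V where "V = topspace X1 - {x1}"
  have V: "openin X1 V" "x1 \<notin> V" "x \<in> V"
    using closed x by (auto simp: V_def)
  have VX: "openin X (Inl ` V)"
    unfolding X_def using V by (intro openin_wedge_Inl)
  have b: "Inl x \<in> (Inl ` V :: ('a + 'b) set)"
    using V(3) by simp
  show "\<exists>g. hawaiian_map n X1 x g \<and>
      homotopic_with (\<lambda>h. h earring_base = Inl x) (hawaiian_earring n) X f (Inl \<circ> g)"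
    if f: "hawaiian_map n X (Inl x) f" for f
  proof -
    obtain g where g: "hawaiian_map n X (Inl x) g"
      "g ` topspace (hawaiian_earring n) \<subseteq> Inl ` V"
      "homotopic_with (\<lambda>h. h earring_base = Inl x) (hawaiian_earring n) X f g"
      using hawaiian_map_homotopic_into_open[OF small VX b f] by blast
    \<comment> \<open>Off the earring the values of \<open>g\<close> are unrestricted and may lie in
      the other summand, so \<open>g\<close> and \<open>Inl \<circ> (projl \<circ> g)\<close> need
      not be equal as functions.\<close>
    have "homotopic_with (\<lambda>h. h earring_base = Inl x) (hawaiian_earring n) X g (Inl \<circ> (projl \<circ> g))"
      using g(1,2) by (intro homotopic_with_equal) (auto simp: hawaiian_map_def)
    moreover have "hawaiian_map n X1 x (projl \<circ> g)"
      using g(1) continuous_map_projl_wedge[OF _ V(1,2) g(2), of X2 x2]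
      by (simp add: hawaiian_map_def X_def)
    ultimately show ?thesis
      using homotopic_with_trans[OF g(3)] by blast
  qed
qed

theorem theorem3p5:
  fixes X1 :: "'a topology" and X2 :: "'b topology"
    and x1 :: 'a and x2 :: 'b and n :: nat
  assumes "x1 \<in> topspace X1" and "x2 \<in> topspace X2"
    and "n \<ge> 1"
    and "closedin X1 {x1}"
  shows "((\<forall>\<alpha>. n_loop n (wedge X1 x1 X2 x2) (Inl x1) \<alpha> \<longrightarrow>
              small_n_loop n (wedge X1 x1 X2 x2) (Inl x1) \<alpha>) \<longleftrightarrow>
          (\<forall>U1 U2. neighbourhood_in X1 x1 U1 \<and> neighbourhood_in X2 x2 U2 \<longrightarrow>
             carrier (hawaiian_group n (wedge X1 x1 X2 x2) (Inl x1)) =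
             hawaiian_induced n (wedge X1 x1 X2 x2) (Inl x1) id `
               carrier (hawaiian_group n
                 (wedge (subtopology X1 U1) x1 (subtopology X2 U2) x2) (Inl x1))))
       \<and> (\<forall>x. x \<in> topspace X1 \<and> x \<noteq> x1 \<longrightarrow>
           (\<forall>\<alpha>. n_loop n (wedge X1 x1 X2 x2) (Inl x) \<alpha> \<longrightarrow>
              small_n_loop n (wedge X1 x1 X2 x2) (Inl x) \<alpha>) \<longrightarrow>
           carrier (hawaiian_group n (wedge X1 x1 X2 x2) (Inl x)) =
           hawaiian_induced n (wedge X1 x1 X2 x2) (Inl x) Inl `
             carrier (hawaiian_group n X1 x))"
proof (intro conjI iffI allI impI, goal_cases)
  case (1 U1 U2)
  then show ?case
    by (intro hawaiian_group_eq_neighbourhoods_if_small) simp_all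
next
  case (2 \<alpha>)
  show ?case
    by (rule small_n_loop_if_hawaiian_group_eq_neighbourhoods[OF assms(1,2) _ 2(2)])
      (rule 2(1)[rule_format], rule conjI)
next
  case (3 x)
  then show ?case
    by (intro hawaiian_group_wedge_eq_summand assms(4)) simp_all
qed

end
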